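(* Let $X$, $Y$, $B$, $\varepsilon$, $I$, $I_0$, $I_1$, the permutation $\sigma$ of $I$ and the dimensionality $s\in I$ be as defined in the context. Then $$I_1=\{\sigma(k):1\le k\le s\}.$$
   Context: Let $p,q\ge2$, let $X$ and $Y$ be random vectors in $\mathbb{R}^p$ and $\mathbb{R}^q$, and let $Y=BX+\varepsilon$, where $B=(b_{ij})$ is a real $q\times p$ matrix and $\varepsilon$ is a random vector in $\mathbb{R}^q$ independent of $X$. Assume that $X$ and $Y$ are centered (hence so is $\varepsilon$), that $\mathbb{E}\|X\|^4<\infty$ and $\mathbb{E}\|Y\|^4<\infty$, and that $V_1=\mathbb{E}(XX^T)$ (a $p\times p$ matrix) is invertible. Put $V_{12}=\mathbb{E}(XY^T)$ (a $p\times q$ matrix). Let $I=\{1,\dots,p\}$, let $\mathbf{b}_{\bullet j}=(b_{1j},\dots,b_{qj})^T$ be the $j$-th column of $B$, let $I_0=\{j\in I:\mathbf{b}_{\bullet j}=0\}$, and let $I_1=I\setminus I_0$. Assume that $I_0$ and $I_1$ are non-empty. For $K\subset I$ let $A_K:\mathbb{R}^p\to\mathbb{R}^{\mathrm{card}(K)}$ be the map $(x_i)_{i\in I}\mapsto(x_i)_{i\in K}$, let $\Pi_K=A_K^*(A_KV_1A_K^* )^{-1}A_K$ (where $A^*$ is the adjoint of $A$), and let $\xi_K=\|V_{12}-V_1\Pi_KV_{12}\|$, with $\|A\|=\sqrt{\mathrm{tr}(A^*A)}$. Put $K_i=I\setminus\{i\}$. $\sigma$ is the unique permutation of $I$ such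 that $\xi_{K_{\sigma(1)}}\ge\xi_{K_{\sigma(2)}}\ge\cdots\ge\xi_{K_{\sigma(p)}}$ and such that $\xi_{K_{\sigma(i)}}=\xi_{K_{\sigma(j)}}$ with $i<j$ implies $\sigma(i)<\sigma(j)$. The dimensionality $s\in I$ is the integer with $\xi_{K_{\sigma(1)}}\ge\cdots\ge\xi_{K_{\sigma(s)}}>0=\xi_{K_{\sigma(s+1)}}=\cdots=\xi_{K_{\sigma(p)}}$. *)

theory Defs
  imports
    "HOL-Probability.Probability"
    "Jordan_Normal_Form.Gauss_Jordan_Elimination"
    "Jordan_Normal_Form.DL_Submatrix"
begin

no_notation vec_nth (infixl "$" 90)
no_notation inner (infix "\<bullet>" 70)

text \<open>Vectors and matrices are those of \<^theory>\<open>Jordan_Normal_Form.Matrix\<close>: dimensions are natural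
  numbers, and indices run from 0, so that the index set \<open>{1, ..., p}\<close> becomes \<open>{..<p}\<close>.\<close>

text \<open>The Borel sigma-algebra of \<open>\<real>\<^sup>n\<close>, carried over from the product sigma-algebra, since
  \<^typ>\<open>real vec\<close> carries no topology.\<close>

definition vec_borel :: "nat \<Rightarrow> real vec measure" where
  "vec_borel n = vimage_algebra (carrier_vec n) (\<lambda>v. \<lambda>i\<in>{..<n}. v $ i) (\<Pi>\<^sub>M i\<in>{..<n}. borel)"

lemma space_vec_borel [simp]: "space (vec_borel n) = carrier_vec n"
  by (simp add: vec_borel_def)

lemma measurable_vec_borel_iff:
  "X \<in> M \<rightarrow>\<^sub>M vec_borel n \<longleftrightarrow>
     X \<in> space M \<rightarrow> carrier_vec n \<and> (\<forall>i<n. (\<lambda>w. X w $ i) \<in> borel_measurable M)"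
proof (intro iffI conjI allI impI)
  assume X: "X \<in> M \<rightarrow>\<^sub>M vec_borel n"
  show "X \<in> space M \<rightarrow> carrier_vec n"
    using measurable_space[OF X] by auto
  fix i assume i: "i < n"
  have "(\<lambda>v. \<lambda>i\<in>{..<n}. v $ i) \<in> vec_borel n \<rightarrow>\<^sub>M (\<Pi>\<^sub>M i\<in>{..<n}. borel)"
    unfolding vec_borel_def by (intro measurable_vimage_algebra1) (auto simp: space_PiM)
  from measurable_compose[OF X this]
  have "(\<lambda>w. \<lambda>i\<in>{..<n}. X w $ i) \<in> M \<rightarrow>\<^sub>M (\<Pi>\<^sub>M i\<in>{..<n}. borel)" .
  from measurable_compose[OF this measurable_component_singleton[of i]] i
  show "(\<lambda>w. X w $ i) \<in> borel_measurable M" by simp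
next
  assume X: "X \<in> space M \<rightarrow> carrier_vec n \<and> (\<forall>i<n. (\<lambda>w. X w $ i) \<in> borel_measurable M)"
  show "X \<in> M \<rightarrow>\<^sub>M vec_borel n"
    unfolding vec_borel_def
    by (intro measurable_vimage_algebra2 measurable_restrict) (use X in auto)
qed

definition vec_norm2 :: "real vec \<Rightarrow> real" where
  "vec_norm2 v = sqrt (v \<bullet> v)"

definition centered :: "'a measure \<Rightarrow> nat \<Rightarrow> ('a \<Rightarrow> real vec) \<Rightarrow> bool" where
  "centered M n X \<longleftrightarrow> (\<forall>i<n. integrable M (\<lambda>w. X w $ i) \<and> (\<integral>w. X w $ i \<partial>M) = 0)"

text \<open>The matrix \<open>E (X Y\<^sup>T)\<close>.\<close>

definition cross_moment ::
  "'a measure \<Rightarrow> nat \<Rightarrow> nat \<Rightarrow> ('a \<Rightarrow> real vec) \<Rightarrow> ('a \<Rightarrow> real vec) \<Rightarrow> real mat" where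
  "cross_moment M m n X Y = mat m n (\<lambda>(i, j). \<integral>w. X w $ i * Y w $ j \<partial>M)"

text \<open>The matrix of the coordinate selection \<open>A\<^sub>K\<close>: the rows of the identity matrix indexed by \<open>K\<close>,
  in increasing order.\<close>

definition sel_mat :: "nat \<Rightarrow> nat set \<Rightarrow> real mat" where
  "sel_mat p K = submatrix (1\<^sub>m p) K UNIV"

lemma sel_mat_mult_vec:
  assumes "K \<subseteq> {..<p}" "x \<in> carrier_vec p"
  shows "sel_mat p K *\<^sub>v x = vec (card K) (\<lambda>i. x $ pick K i)"
proof -
  have K: "{i. i < p \<and> i \<in> K} = K" using assms(1) by auto
  have dims: "dim_row (sel_mat p K) = card K" "dim_col (sel_mat p K) = p"
    by (simp_all add: sel_mat_def dim_submatrix K)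
  show ?thesis
  proof (rule eq_vecI)
    fix i assume "i < dim_vec (vec (card K) (\<lambda>i. x $ pick K i))"
    then have i: "i < card K" by simp
    have "pick K i \<in> K" using pick_in_set i by blast
    then have lt: "pick K i < p" using assms(1) by auto
    have "row (sel_mat p K) i = unit_vec p (pick K i)"
      by (rule eq_vecI)
         (use i lt in \<open>auto simp: dims sel_mat_def submatrix_index dim_submatrix K pick_UNIV\<close>)
    then show "(sel_mat p K *\<^sub>v x) $ i = vec (card K) (\<lambda>i. x $ pick K i) $ i"
      using i lt assms(2) by (simp add: dims)
  qed (simp add: dims)
qed

definition mat_inv :: "real mat \<Rightarrow> real mat" where
  "mat_inv A = the (mat_inverse A)"

lemma mat_inv:
  assumes "A \<in> carrier_mat n n" "invertible_mat A"
  shows "mat_inv A \<in> carrier_mat n n" "A * mat_inv A = 1\<^sub>m n" "mat_inv A * A = 1\<^sub>m n"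
proof -
  from assms(2) obtain B where B: "inverts_mat A B" "inverts_mat B A"
    by (auto simp: invertible_mat_def)
  have eqs: "A * B = 1\<^sub>m n" "B * A = 1\<^sub>m (dim_row B)"
    using B assms(1) by (auto simp: inverts_mat_def)
  have "dim_col B = n" using arg_cong[OF eqs(1), of dim_col] by simp
  moreover have "dim_row B = n" using arg_cong[OF eqs(2), of dim_col] assms(1) by simp
  ultimately have "A \<in> Units (ring_mat TYPE(real) n ())"
    using eqs assms(1) by (auto simp: Units_def ring_mat_def intro!: bexI[of _ B])
  then obtain C where C: "mat_inverse A = Some C"
    using mat_inverse(1)[OF assms(1), of "()"] by (cases "mat_inverse A") auto
  show "mat_inv A \<in> carrier_mat n n" "A * mat_inv A = 1\<^sub>m n" "mat_inv A * A = 1\<^sub>m n"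
    using mat_inverse(2)[OF assms(1) C] by (simp_all add: mat_inv_def C)
qed

definition Pi_mat :: "nat \<Rightarrow> real mat \<Rightarrow> nat set \<Rightarrow> real mat" where
  "Pi_mat p V K = transpose_mat (sel_mat p K)
     * mat_inv (sel_mat p K * V * transpose_mat (sel_mat p K)) * sel_mat p K"

definition mat_trace :: "real mat \<Rightarrow> real" where
  "mat_trace A = (\<Sum>i<dim_row A. A $$ (i, i))"

definition mat_norm :: "real mat \<Rightarrow> real" where
  "mat_norm A = sqrt (mat_trace (transpose_mat A * A))"

definition xi :: "nat \<Rightarrow> real mat \<Rightarrow> real mat \<Rightarrow> nat set \<Rightarrow> real" where
  "xi p V1 V12 K = mat_norm (V12 - V1 * Pi_mat p V1 K * V12)"

text \<open>\<open>\<sigma>\<close> sorts \<open>{..<p}\<close> by decreasing value of \<open>f\<close>, ties being broken by the natural order.\<close>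

definition ranks_decreasingly :: "nat \<Rightarrow> (nat \<Rightarrow> real) \<Rightarrow> (nat \<Rightarrow> nat) \<Rightarrow> bool" where
  "ranks_decreasingly p f \<sigma> \<longleftrightarrow> \<sigma> permutes {..<p}
     \<and> (\<forall>i<p. \<forall>j<p. i < j \<longrightarrow> f (\<sigma> i) \<ge> f (\<sigma> j))
     \<and> (\<forall>i<p. \<forall>j<p. i < j \<and> f (\<sigma> i) = f (\<sigma> j) \<longrightarrow> \<sigma> i < \<sigma> j)"

text \<open>As positions run from 0, the first \<open>s\<close> positions are those below \<open>s\<close>.\<close>

definition is_dimensionality :: "nat \<Rightarrow> (nat \<Rightarrow> real) \<Rightarrow> (nat \<Rightarrow> nat) \<Rightarrow> nat \<Rightarrow> bool" where
  "is_dimensionality p f \<sigma> s \<longleftrightarrow> s \<in> {1..p}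
     \<and> (\<forall>k<s. f (\<sigma> k) > 0) \<and> (\<forall>k. s \<le> k \<and> k < p \<longrightarrow> f (\<sigma> k) = 0)"

end

theory Submission
  imports Defs "Jordan_Normal_Form.Determinant"
begin

text \<open>
  Why the theorem holds.  Write \<open>C\<close> for the transpose of \<open>B\<close>, so that column \<open>j\<close> of \<open>B\<close> is row \<open>j\<close>
  of \<open>C\<close>.  The noise is centered and independent of \<open>X\<close>, hence uncorrelated with it, and the linear
  model gives \<open>V12 = V1 C\<close> (lemma \<open>cross_moment_linear_model\<close>).  Since \<open>V1\<close> can be cancelled,
  \<open>\<xi> K = 0\<close> says that \<open>\<Pi> V1\<close> fixes \<open>C\<close>, where \<open>\<Pi>\<close> is the matrix \<open>\<Pi>\<^sub>K\<close>.

  Now \<open>\<Pi> V1\<close> is a projection onto the vectors supported in \<open>K\<close>.  Its range lies there because its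
  leftmost factor is the transpose of the selection \<open>S\<close> of the coordinates in \<open>K\<close>.  It fixes every
  such vector \<open>x\<close> because \<open>x = S\<^sup>T S x\<close>, which lets the factor \<open>S V1 S\<^sup>T\<close> meet its own inverse.
  So \<open>\<xi> K = 0\<close> exactly when the rows of \<open>C\<close> outside \<open>K\<close> vanish (lemma \<open>xi_eq_0_iff\<close>).  For
  \<open>K = I - {i}\<close> this reads: column \<open>i\<close> of \<open>B\<close> is zero.  The first \<open>s\<close> positions of \<open>\<sigma>\<close> are by
  definition those where \<open>\<xi>\<close> is positive, so they list \<open>I1\<close>.

  The inverse of \<open>S V1 S\<^sup>T\<close> exists because \<open>V1\<close> is not only invertible but anisotropic, that is,
  \<open>u \<bullet> V1 u = 0\<close> forces \<open>u = 0\<close>, and this property passes to compressions.  It holds because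
  \<open>u \<bullet> V1 u\<close> is the second moment of \<open>u \<bullet> X\<close> (lemma \<open>cross_moment_anisotropic\<close>).
\<close>

section \<open>Coordinate selections\<close>

lemma sel_mat_carrier:
  assumes "K \<subseteq> {..<p}"
  shows "sel_mat p K \<in> carrier_mat (card K) p"
proof -
  have "{i. i < p \<and> i \<in> K} = K" using assms by auto
  then show ?thesis
    by (intro carrier_matI) (simp_all add: sel_mat_def dim_submatrix)
qed

lemma sel_mat_index:
  assumes "K \<subseteq> {..<p}" "k < card K" "j < p"
  shows "sel_mat p K $$ (k, j) = (if pick K k = j then 1 else 0)"
proof -
  have K: "{i. i < p \<and> i \<in> K} = K" using assms by auto
  have "pick K k \<in> K" using pick_in_set assms(2) by blast
  then have "pick K k < p" using assms(1) by auto
  then show ?thesis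
    using assms by (simp add: sel_mat_def submatrix_index dim_submatrix K pick_UNIV)
qed

text \<open>Distinct rows of the selection pick distinct coordinates, so its rows are orthonormal.\<close>

lemma sel_mat_mult_transpose:
  assumes "K \<subseteq> {..<p}"
  shows "sel_mat p K * transpose_mat (sel_mat p K) = 1\<^sub>m (card K)"
proof (rule eq_matI)
  have S: "sel_mat p K \<in> carrier_mat (card K) p" by (rule sel_mat_carrier[OF assms])
  fix k l assume "k < dim_row (1\<^sub>m (card K) :: real mat)" "l < dim_col (1\<^sub>m (card K) :: real mat)"
  then have kl: "k < card K" "l < card K" by auto
  have p: "pick K l < p" using pick_in_set[of l K] kl(2) assms by auto
  have inj: "pick K k = pick K l \<longleftrightarrow> k = l"
    using pick_mono[of k K l] pick_mono[of l K k] kl by (metis less_irrefl nat_neq_iff)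
  have "(sel_mat p K * transpose_mat (sel_mat p K)) $$ (k, l)
      = (sel_mat p K *\<^sub>v row (sel_mat p K) l) $ k"
    using S kl by simp
  also have "\<dots> = row (sel_mat p K) l $ pick K k"
    using kl S by (subst sel_mat_mult_vec[OF assms]) auto
  also have "\<dots> = (if k = l then 1 else 0)"
    using kl S pick_in_set[of k K] assms inj by (auto simp: sel_mat_index[OF assms])
  finally show "(sel_mat p K * transpose_mat (sel_mat p K)) $$ (k, l) = 1\<^sub>m (card K) $$ (k, l)"
    using kl by simp
qed (use sel_mat_carrier[OF assms] in auto)

lemma sel_mat_mult_index:
  assumes "K \<subseteq> {..<p}" "C \<in> carrier_mat p n" "k < card K" "j < n"
  shows "(sel_mat p K * C) $$ (k, j) = C $$ (pick K k, j)"
proof -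
  have S: "sel_mat p K \<in> carrier_mat (card K) p" by (rule sel_mat_carrier[OF assms(1)])
  have "(sel_mat p K * C) $$ (k, j) = (sel_mat p K *\<^sub>v col C j) $ k"
    using S assms by simp
  also have "\<dots> = col C j $ pick K k"
    using assms by (subst sel_mat_mult_vec[OF assms(1)]) auto
  finally show ?thesis
    using assms pick_in_set[of k K] by auto
qed

lemma transpose_sel_mat_mult_index:
  assumes "K \<subseteq> {..<p}" "D \<in> carrier_mat (card K) n" "i < p" "j < n"
  shows "(transpose_mat (sel_mat p K) * D) $$ (i, j)
    = (\<Sum>k<card K. if pick K k = i then D $$ (k, j) else 0)"
proof -
  have S: "sel_mat p K \<in> carrier_mat (card K) p" by (rule sel_mat_carrier[OF assms(1)])
  have "(transpose_mat (sel_mat p K) * D) $$ (i, j)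
      = (\<Sum>k<card K. sel_mat p K $$ (k, i) * D $$ (k, j))"
    using S assms by (simp add: scalar_prod_def atLeast0LessThan)
  also have "\<dots> = (\<Sum>k<card K. if pick K k = i then D $$ (k, j) else 0)"
    using assms by (intro sum.cong) (auto simp: sel_mat_index[OF assms(1)])
  finally show ?thesis .
qed

text \<open>Selecting coordinates and then reinserting them sets the coordinates outside \<open>K\<close> to zero, which
  changes nothing for a matrix whose rows there are zero already.\<close>

lemma transpose_sel_mat_mult_sel_mat_mult:
  assumes K: "K \<subseteq> {..<p}" and C: "C \<in> carrier_mat p n"
    and zero: "\<And>i j. i < p \<Longrightarrow> i \<notin> K \<Longrightarrow> j < n \<Longrightarrow> C $$ (i, j) = 0"
  shows "transpose_mat (sel_mat p K) * (sel_mat p K * C) = C"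
proof (rule eq_matI)
  have S: "sel_mat p K \<in> carrier_mat (card K) p" by (rule sel_mat_carrier[OF K])
  have SC: "sel_mat p K * C \<in> carrier_mat (card K) n" using S C by simp
  fix i j assume "i < dim_row C" "j < dim_col C"
  then have ij: "i < p" "j < n" using C by auto
  have "(transpose_mat (sel_mat p K) * (sel_mat p K * C)) $$ (i, j)
      = (\<Sum>k<card K. if pick K k = i then C $$ (i, j) else 0)"
    unfolding transpose_sel_mat_mult_index[OF K SC ij]
    by (intro sum.cong) (auto simp: sel_mat_mult_index[OF K C _ ij(2)])
  also have "\<dots> = C $$ (i, j)"
  proof (cases "i \<in> K")
    case True
    have fin: "finite K" using K finite_subset by blast
    \<comment> \<open>The position of \<open>i\<close> in \<open>K\<close>, which is the only index that contributes to the sum.\<close>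
    define m where "m = card {a \<in> K. a < i}"
    have m: "m < card K" "pick K m = i"
      unfolding m_def using True fin
      by (auto intro!: psubset_card_mono simp: pick_card_in_set)
    have "pick K k = i \<longleftrightarrow> k = m" if "k < card K" for k
      using pick_mono[of k K m] pick_mono[of m K k] that m by (metis less_irrefl nat_neq_iff)
    then have "(\<Sum>k<card K. if pick K k = i then C $$ (i, j) else 0)
        = (\<Sum>k<card K. if k = m then C $$ (i, j) else 0)"
      by (intro sum.cong) auto
    then show ?thesis using m by simp
  next
    case False
    then show ?thesis unfolding zero[OF ij(1) False ij(2)] by simp
  qed
  finally show "(transpose_mat (sel_mat p K) * (sel_mat p K * C)) $$ (i, j) = C $$ (i, j)" .
qed (use sel_mat_carrier[OF K] C in auto)

section \<open>The criterion for an anisotropic covariance matrix\<close>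

lemma invertible_mat_if_trivial_kernel:
  fixes A :: "'a :: field mat"
  assumes A: "A \<in> carrier_mat n n"
    and ker: "\<And>v. v \<in> carrier_vec n \<Longrightarrow> A *\<^sub>v v = 0\<^sub>v n \<Longrightarrow> v = 0\<^sub>v n"
  shows "invertible_mat A"
proof -
  have "det A \<noteq> 0"
    using det_0_iff_vec_prod_zero_field[OF A] ker by auto
  from det_non_zero_imp_unit[OF A this]
  obtain C where "C \<in> carrier_mat n n" "A * C = 1\<^sub>m n" "C * A = 1\<^sub>m n"
    by (auto simp: Units_def ring_mat_def)
  then show ?thesis
    using A by (auto simp: invertible_mat_def inverts_mat_def intro!: exI[of _ C])
qed

text \<open>A bare invertible matrix may have singular principal submatrices.  Anisotropy excludes this: if
  \<open>S V S\<^sup>T v = 0\<close>, then \<open>u = S\<^sup>T v\<close> satisfies \<open>u \<bullet> V u = v \<bullet> S V S\<^sup>T v = 0\<close>, so \<open>u = 0\<close>, and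
  \<open>v = S u\<close> recovers \<open>v\<close>.\<close>

lemma invertible_compression:
  assumes K: "K \<subseteq> {..<p}" and V: "V \<in> carrier_mat p p"
    and aniso: "\<And>u. u \<in> carrier_vec p \<Longrightarrow> u \<bullet> (V *\<^sub>v u) = 0 \<Longrightarrow> u = 0\<^sub>v p"
  shows "invertible_mat (sel_mat p K * V * transpose_mat (sel_mat p K))"
proof (rule invertible_mat_if_trivial_kernel)
  let ?S = "sel_mat p K" and ?T = "transpose_mat (sel_mat p K)"
  have S: "?S \<in> carrier_mat (card K) p" and T: "?T \<in> carrier_mat p (card K)"
    using sel_mat_carrier[OF K] by simp_all
  show "?S * V * ?T \<in> carrier_mat (card K) (card K)" using S T V by simp
  fix v :: "real vec" assume v: "v \<in> carrier_vec (card K)" and 0: "?S * V * ?T *\<^sub>v v = 0\<^sub>v (card K)"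
  define u where "u = ?T *\<^sub>v v"
  have u: "u \<in> carrier_vec p" unfolding u_def using T v by simp
  have "?S *\<^sub>v (V *\<^sub>v u) = 0\<^sub>v (card K)"
    using 0 assoc_mult_mat_vec[of "?S * V" "card K" p ?T "card K" v] assoc_mult_mat_vec[OF S V u]
      S V T v by (simp add: u_def)
  moreover have "u \<bullet> (V *\<^sub>v u) = v \<bullet> (?S *\<^sub>v (V *\<^sub>v u))"
    unfolding u_def
    using transpose_vec_mult_scalar[OF S _ v, of "V *\<^sub>v u"] u V unfolding u_def by simp
  ultimately have "u = 0\<^sub>v p" using aniso[OF u] v by simp
  then have "?S *\<^sub>v u = 0\<^sub>v (card K)" using S by (intro eq_vecI) simp_all
  moreover have "?S *\<^sub>v u = v"
    unfolding u_def using S T v sel_mat_mult_transpose[OF K]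
    by (simp add: assoc_mult_mat_vec[symmetric])
  ultimately show "v = 0\<^sub>v (card K)" by simp
qed

text \<open>The product \<open>\<Pi> V\<close> is a projection onto the vectors supported in \<open>K\<close>, so its fixed points are
  those vectors; here this is applied to all columns of \<open>C\<close> at once.\<close>

lemma Pi_mat_fixes_iff:
  assumes K: "K \<subseteq> {..<p}" and V: "V \<in> carrier_mat p p" and C: "C \<in> carrier_mat p n"
    and aniso: "\<And>u. u \<in> carrier_vec p \<Longrightarrow> u \<bullet> (V *\<^sub>v u) = 0 \<Longrightarrow> u = 0\<^sub>v p"
  shows "Pi_mat p V K * (V * C) = C \<longleftrightarrow> (\<forall>i<p. i \<notin> K \<longrightarrow> (\<forall>j<n. C $$ (i, j) = 0))"
proof -
  let ?S = "sel_mat p K" and ?T = "transpose_mat (sel_mat p K)"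
  have S: "?S \<in> carrier_mat (card K) p" and T: "?T \<in> carrier_mat p (card K)"
    using sel_mat_carrier[OF K] by simp_all
  define G where "G = ?S * V * ?T"
  have G: "G \<in> carrier_mat (card K) (card K)" unfolding G_def using S T V by simp
  have "invertible_mat G" unfolding G_def by (rule invertible_compression[OF K V aniso])
  note inv = mat_inv[OF G this]
  define D where "D = mat_inv G * (?S * (V * C))"
  have D: "D \<in> carrier_mat (card K) n" unfolding D_def using inv(1) S V C by simp
  have Pi: "Pi_mat p V K * (V * C) = ?T * D"
    unfolding Pi_mat_def G_def[symmetric] D_def
    using assoc_mult_mat[of "?T * mat_inv G" p "card K" ?S p "V * C" n]
      assoc_mult_mat[OF T inv(1), of "?S * (V * C)" n] S T V C inv(1) by simp
  show ?thesis
  proof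
    assume eq: "Pi_mat p V K * (V * C) = C"
    show "\<forall>i<p. i \<notin> K \<longrightarrow> (\<forall>j<n. C $$ (i, j) = 0)"
    proof (intro allI impI)
      fix i j assume i: "i < p" "i \<notin> K" and j: "j < n"
      have "pick K k \<noteq> i" if "k < card K" for k
        using pick_in_set[of k K] that i(2) by auto
      then show "C $$ (i, j) = 0"
        using transpose_sel_mat_mult_index[OF K D i(1) j] unfolding Pi[symmetric] eq by simp
    qed
  next
    assume "\<forall>i<p. i \<notin> K \<longrightarrow> (\<forall>j<n. C $$ (i, j) = 0)"
    then have supp: "?T * (?S * C) = C"
      by (intro transpose_sel_mat_mult_sel_mat_mult[OF K C]) auto
    have SC: "?S * C \<in> carrier_mat (card K) n" using S C by simp
    \<comment> \<open>Inserting \<open>C = S\<^sup>T S C\<close> makes the Gram factor \<open>G\<close> appear next to its inverse.\<close>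
    have "?S * (V * C) = ?S * (V * (?T * (?S * C)))" by (simp only: supp)
    also have "\<dots> = G * (?S * C)"
      unfolding G_def using assoc_mult_mat[OF V T SC] assoc_mult_mat[OF S V, of "?T * (?S * C)" n]
        assoc_mult_mat[of "?S * V" "card K" p ?T "card K" "?S * C" n] S T V SC by simp
    finally have "D = mat_inv G * (G * (?S * C))" unfolding D_def by simp
    also have "\<dots> = ?S * C"
      using assoc_mult_mat[OF inv(1) G SC] left_mult_one_mat[OF SC] by (simp only: inv(3))
    finally show "Pi_mat p V K * (V * C) = C" unfolding Pi by (simp add: supp)
  qed
qed

lemma mat_norm_eq_0_iff:
  assumes A: "A \<in> carrier_mat m n"
  shows "mat_norm A = 0 \<longleftrightarrow> A = 0\<^sub>m m n"
proof -
  have tr: "mat_trace (transpose_mat A * A) = (\<Sum>j<n. \<Sum>i<m. (A $$ (i, j))\<^sup>2)"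
    using A by (simp add: mat_trace_def scalar_prod_def atLeast0LessThan power2_eq_square)
  have "mat_norm A = 0 \<longleftrightarrow> (\<forall>j<n. \<forall>i<m. A $$ (i, j) = 0)"
    by (simp add: mat_norm_def tr sum_nonneg_eq_0_iff sum_nonneg Ball_def)
  also have "\<dots> \<longleftrightarrow> A = 0\<^sub>m m n" using A by (auto intro!: eq_matI)
  finally show ?thesis .
qed

text \<open>The form \<open>V C\<close> of the cross moment lets the outer \<open>V\<close> be cancelled, which turns the vanishing
  of \<open>\<xi>\<close> into the fixed point equation of the projection.\<close>

lemma xi_eq_0_iff:
  assumes K: "K \<subseteq> {..<p}" and V: "V \<in> carrier_mat p p" and C: "C \<in> carrier_mat p n"
    and aniso: "\<And>u. u \<in> carrier_vec p \<Longrightarrow> u \<bullet> (V *\<^sub>v u) = 0 \<Longrightarrow> u = 0\<^sub>v p"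
  shows "xi p V (V * C) K = 0 \<longleftrightarrow> (\<forall>i<p. i \<notin> K \<longrightarrow> (\<forall>j<n. C $$ (i, j) = 0))"
proof -
  have "invertible_mat V"
    using aniso by (intro invertible_mat_if_trivial_kernel[OF V]) simp
  note inv = mat_inv[OF V this]
  define R where "R = Pi_mat p V K"
  have R: "R \<in> carrier_mat p p"
    using sel_mat_carrier[OF K] by (intro carrier_matI) (simp_all add: R_def Pi_mat_def)
  have VC: "V * C \<in> carrier_mat p n" and RVC: "R * (V * C) \<in> carrier_mat p n"
    using V C R by simp_all
  have cancel: "mat_inv V * (V * E) = E" if "E \<in> carrier_mat p n" for E
    using assoc_mult_mat[OF inv(1) V that] inv(3) that by simp
  have "xi p V (V * C) K = 0 \<longleftrightarrow> V * C - V * (R * (V * C)) = 0\<^sub>m p n"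
    unfolding xi_def R_def[symmetric] assoc_mult_mat[OF V R VC]
    by (intro mat_norm_eq_0_iff minus_carrier_mat mult_carrier_mat[OF V RVC])
  also have "\<dots> \<longleftrightarrow> V * (R * (V * C)) = V * C"
  proof
    assume z: "V * C - V * (R * (V * C)) = 0\<^sub>m p n"
    show "V * (R * (V * C)) = V * C"
    proof (rule eq_matI)
      fix i j assume "i < dim_row (V * C)" "j < dim_col (V * C)"
      then show "(V * (R * (V * C))) $$ (i, j) = (V * C) $$ (i, j)"
        using arg_cong[OF z, of "\<lambda>A. A $$ (i, j)"] C VC V RVC
        by (simp del: index_mult_mat(1))
    qed (use V VC RVC R in auto)
  qed (use VC in simp)
  also have "\<dots> \<longleftrightarrow> R * (V * C) = C"
    using cancel[OF RVC] cancel[OF C] by metis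
  also have "\<dots> \<longleftrightarrow> (\<forall>i<p. i \<notin> K \<longrightarrow> (\<forall>j<n. C $$ (i, j) = 0))"
    unfolding R_def by (rule Pi_mat_fixes_iff[OF K V C aniso])
  finally show ?thesis .
qed

section \<open>Second moments\<close>

lemma vec_index_sq_le:
  fixes v :: "real vec"
  assumes "v \<in> carrier_vec n" "i < n"
  shows "(v $ i)\<^sup>2 \<le> v \<bullet> v"
  using assms member_le_sum[of i "{0..<n}" "\<lambda>i. (v $ i)\<^sup>2"]
  by (simp add: scalar_prod_def power2_eq_square)

text \<open>The product of two coordinates is at most \<open>t = \<parallel>X\<parallel>\<^sup>2\<close> in absolute value, and \<open>t \<le> 1 + t\<^sup>2\<close>
  with \<open>t\<^sup>2 = \<parallel>X\<parallel>\<^sup>4\<close>; the constant 1 is integrable because the measure is finite.\<close>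

lemma (in prob_space) integrable_mult_index:
  assumes X: "X \<in> M \<rightarrow>\<^sub>M vec_borel n" and int: "integrable M (\<lambda>w. vec_norm2 (X w) ^ 4)"
    and "i < n" "j < n"
  shows "integrable M (\<lambda>w. X w $ i * X w $ j)"
proof (rule Bochner_Integration.integrable_bound)
  show "integrable M (\<lambda>w. 1 + vec_norm2 (X w) ^ 4)" using int by simp
  show "(\<lambda>w. X w $ i * X w $ j) \<in> borel_measurable M"
    using X assms(3,4) by (intro borel_measurable_times) (simp_all add: measurable_vec_borel_iff)
  show "AE w in M. norm (X w $ i * X w $ j) \<le> norm (1 + vec_norm2 (X w) ^ 4)"
  proof (rule AE_I2)
    fix w assume "w \<in> space M"
    then have c: "X w \<in> carrier_vec n" using X by (auto simp: measurable_vec_borel_iff)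
    let ?a = "X w $ i" and ?b = "X w $ j" and ?t = "X w \<bullet> X w"
    have a: "?a\<^sup>2 \<le> ?t" and b: "?b\<^sup>2 \<le> ?t" using c assms(3,4) by (simp_all add: vec_index_sq_le)
    have t: "0 \<le> ?t" using a zero_le_power2[of ?a] by linarith
    have "vec_norm2 (X w) ^ 4 = (vec_norm2 (X w) ^ 2) ^ 2" by simp
    also have "\<dots> = ?t\<^sup>2" using t by (simp add: vec_norm2_def)
    finally have n4: "vec_norm2 (X w) ^ 4 = ?t\<^sup>2" .
    have "2 * \<bar>?a * ?b\<bar> \<le> ?a\<^sup>2 + ?b\<^sup>2"
      using sum_squares_bound[of "\<bar>?a\<bar>" "\<bar>?b\<bar>"] by (simp add: abs_mult)
    moreover have "2 * ?t \<le> 1 + ?t\<^sup>2" using sum_squares_bound[of 1 ?t] by simp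
    ultimately have "\<bar>?a * ?b\<bar> \<le> 1 + ?t\<^sup>2" using a b t by linarith
    then show "norm (?a * ?b) \<le> norm (1 + vec_norm2 (X w) ^ 4)" unfolding n4 by simp
  qed
qed

text \<open>Linearity of the integral: \<open>E(X Y\<^sup>T) u = E(X (Y \<bullet> u))\<close>.\<close>

lemma cross_moment_mult_vec_index:
  assumes int: "\<And>j. j < n \<Longrightarrow> integrable M (\<lambda>w. X w $ i * Y w $ j)"
    and u: "u \<in> carrier_vec n" and i: "i < m"
  shows "(cross_moment M m n X Y *\<^sub>v u) $ i = (\<integral>w. X w $ i * (\<Sum>j<n. Y w $ j * u $ j) \<partial>M)"
    and "integrable M (\<lambda>w. X w $ i * (\<Sum>j<n. Y w $ j * u $ j))"
proof -
  have int': "integrable M (\<lambda>w. X w $ i * Y w $ j * u $ j)" if "j < n" for j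
    using int[OF that] by simp
  have "(cross_moment M m n X Y *\<^sub>v u) $ i = (\<Sum>j<n. (\<integral>w. X w $ i * Y w $ j \<partial>M) * u $ j)"
    using u i by (simp add: cross_moment_def scalar_prod_def atLeast0LessThan)
  also have "\<dots> = (\<integral>w. (\<Sum>j<n. X w $ i * Y w $ j * u $ j) \<partial>M)"
    using int' by (subst Bochner_Integration.integral_sum) auto
  finally show "(cross_moment M m n X Y *\<^sub>v u) $ i
      = (\<integral>w. X w $ i * (\<Sum>j<n. Y w $ j * u $ j) \<partial>M)"
    by (simp add: sum_distrib_left mult.assoc)
  have "integrable M (\<lambda>w. \<Sum>j<n. X w $ i * Y w $ j * u $ j)"
    using int' by (intro Bochner_Integration.integrable_sum) auto
  then show "integrable M (\<lambda>w. X w $ i * (\<Sum>j<n. Y w $ j * u $ j))"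
    by (simp add: sum_distrib_left mult.assoc)
qed

text \<open>Put \<open>Z = u \<bullet> X\<close>.  If \<open>u \<bullet> V u = E(Z\<^sup>2)\<close> vanishes, then \<open>Z = 0\<close> almost surely, hence
  \<open>V u = E(X Z) = 0\<close>, and \<open>u = 0\<close> since \<open>V\<close> is invertible.\<close>

lemma cross_moment_anisotropic:
  assumes int: "\<And>i j. i < n \<Longrightarrow> j < n \<Longrightarrow> integrable M (\<lambda>w. X w $ i * X w $ j)"
    and inv: "invertible_mat (cross_moment M n n X X)"
    and u: "u \<in> carrier_vec n" and 0: "u \<bullet> (cross_moment M n n X X *\<^sub>v u) = 0"
  shows "u = 0\<^sub>v n"
proof -
  define V where "V = cross_moment M n n X X"
  have V: "V \<in> carrier_mat n n" by (simp add: V_def cross_moment_def)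
  define Z where "Z w = (\<Sum>j<n. X w $ j * u $ j)" for w
  note mom = cross_moment_mult_vec_index[OF int u, folded Z_def]
  have ZZ: "Z w * Z w = (\<Sum>i<n. u $ i * (X w $ i * Z w))" for w
    using sum_distrib_right[of "\<lambda>i. X w $ i * u $ i" "{..<n}" "Z w", folded Z_def]
    by (simp add: mult_ac)
  have intZ: "integrable M (\<lambda>w. Z w * Z w)"
    unfolding ZZ using mom(2) by (intro Bochner_Integration.integrable_sum) auto
  have "(\<integral>w. Z w * Z w \<partial>M) = (\<Sum>i<n. u $ i * (\<integral>w. X w $ i * Z w \<partial>M))"
    unfolding ZZ using mom(2) by (subst Bochner_Integration.integral_sum) auto
  also have "\<dots> = u \<bullet> (V *\<^sub>v u)"
    using u V mom(1) unfolding V_def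
    by (simp add: scalar_prod_def[of u] atLeast0LessThan del: index_mult_mat_vec)
  finally have "(\<integral>w. Z w * Z w \<partial>M) = 0" using 0 by (simp add: V_def)
  then have AE: "AE w in M. Z w = 0"
    using integral_nonneg_eq_0_iff_AE[OF intZ] by simp
  have "V *\<^sub>v u = 0\<^sub>v n"
  proof (rule eq_vecI)
    fix i assume "i < dim_vec (0\<^sub>v n :: real vec)"
    then have i: "i < n" by simp
    have "(V *\<^sub>v u) $ i = (\<integral>w. X w $ i * Z w \<partial>M)" unfolding V_def using mom(1) i by simp
    also have "\<dots> = 0"
      by (rule integral_eq_zero_AE) (use AE in eventually_elim, simp)
    finally show "(V *\<^sub>v u) $ i = 0\<^sub>v n $ i" using i by simp
  qed (use V in simp)
  moreover have "mat_inv V * V = 1\<^sub>m n" "mat_inv V \<in> carrier_mat n n"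
    using mat_inv[OF V] inv by (auto simp: V_def)
  moreover have "mat_inv V *\<^sub>v 0\<^sub>v n = 0\<^sub>v n"
    using \<open>mat_inv V \<in> carrier_mat n n\<close> by (intro eq_vecI) simp_all
  ultimately show "u = 0\<^sub>v n"
    using assoc_mult_mat_vec[of "mat_inv V" n n V n u] V u by simp
qed

text \<open>Expanding \<open>E(X Y\<^sup>T)\<close> by the model leaves the term \<open>E(X \<epsilon>\<^sup>T)\<close>, which factors by independence and
  vanishes because \<open>X\<close> is centered.  Factoring needs \<open>\<epsilon>\<close> to be integrable, which it inherits from
  \<open>\<epsilon> = Y - B X\<close>.\<close>

lemma (in prob_space) cross_moment_linear_model:
  assumes B: "B \<in> carrier_mat q p"
    and X: "X \<in> M \<rightarrow>\<^sub>M vec_borel p" and \<epsilon>: "\<epsilon> \<in> M \<rightarrow>\<^sub>M vec_borel q"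
    and Y: "\<And>w. w \<in> space M \<Longrightarrow> Y w = B *\<^sub>v X w + \<epsilon> w"
    and indep: "indep_var (vec_borel p) X (vec_borel q) \<epsilon>"
    and cX: "centered M p X" and cY: "centered M q Y"
    and int: "\<And>i j. i < p \<Longrightarrow> j < p \<Longrightarrow> integrable M (\<lambda>w. X w $ i * X w $ j)"
  shows "cross_moment M p q X Y = cross_moment M p p X X * transpose_mat B"
proof (rule eq_matI)
  fix i j assume "i < dim_row (cross_moment M p p X X * transpose_mat B)"
    "j < dim_col (cross_moment M p p X X * transpose_mat B)"
  then have i: "i < p" and j: "j < q" using B by (auto simp: cross_moment_def)
  have X': "X w \<in> carrier_vec p" and \<epsilon>': "\<epsilon> w \<in> carrier_vec q" if "w \<in> space M" for w
    using X \<epsilon> that by (auto simp: measurable_vec_borel_iff)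
  have row: "row B j \<in> carrier_vec p" using row_carrier_vec[OF j B] .
  define L where "L w = (\<Sum>k<p. X w $ k * row B j $ k)" for w
  have Yj: "Y w $ j = L w + \<epsilon> w $ j" if "w \<in> space M" for w
    using X'[OF that] \<epsilon>'[OF that] B j unfolding Y[OF that] L_def
    by (simp add: scalar_prod_def atLeast0LessThan mult.commute)
  have Xi: "integrable M (\<lambda>w. X w $ i)" "(\<integral>w. X w $ i \<partial>M) = 0" if "i < p" for i
    using cX that by (auto simp: centered_def)
  have iL: "integrable M L"
    unfolding L_def using Xi(1) by (intro Bochner_Integration.integrable_sum) auto
  have "integrable M (\<lambda>w. Y w $ j - L w)"
    using cY j iL by (auto simp: centered_def)
  then have i\<epsilon>: "integrable M (\<lambda>w. \<epsilon> w $ j)"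
    by (rule Bochner_Integration.integrable_cong[THEN iffD1, rotated 2]) (auto simp: Yj)
  have proj: "(\<lambda>v. v $ k) \<in> borel_measurable (vec_borel n)" if "k < n" for k n
    using measurable_vec_borel_iff[of "\<lambda>v. v" "vec_borel n" n] that by auto
  have ind: "indep_var borel (\<lambda>w. X w $ i) borel (\<lambda>w. \<epsilon> w $ j)"
    using indep_var_compose[OF indep proj[OF i] proj[OF j]] by (simp add: comp_def)
  have iX\<epsilon>: "integrable M (\<lambda>w. X w $ i * \<epsilon> w $ j)"
    by (rule indep_var_integrable[OF ind Xi(1)[OF i] i\<epsilon>])
  have "(\<integral>w. X w $ i * \<epsilon> w $ j \<partial>M) = 0"
    using indep_var_lebesgue_integral[OF ind Xi(1)[OF i] i\<epsilon>] Xi(2)[OF i] by simp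
  note mom = cross_moment_mult_vec_index[of p M X i X, OF int[OF i] row i, folded L_def]
  have "cross_moment M p q X Y $$ (i, j) = (\<integral>w. X w $ i * L w + X w $ i * \<epsilon> w $ j \<partial>M)"
    using i j by (auto simp: cross_moment_def Yj distrib_left intro!: Bochner_Integration.integral_cong)
  also have "\<dots> = (\<integral>w. X w $ i * L w \<partial>M)"
    using mom(2) iX\<epsilon> \<open>(\<integral>w. X w $ i * \<epsilon> w $ j \<partial>M) = 0\<close> by simp
  also have "\<dots> = (cross_moment M p p X X * transpose_mat B) $$ (i, j)"
    using mom(1) i j B by (simp add: cross_moment_def)
  finally show "cross_moment M p q X Y $$ (i, j)
      = (cross_moment M p p X X * transpose_mat B) $$ (i, j)" .
qed (use B in \<open>auto simp: cross_moment_def\<close>)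

section \<open>Reading off the relevant variables\<close>

theorem lemma2:
  fixes M :: "'a measure"
    and p q s :: nat
    and X Y \<epsilon> :: "'a \<Rightarrow> real vec"
    and B V1 V12 :: "real mat"
    and I0 I1 :: "nat set"
    and \<xi> :: "nat set \<Rightarrow> real"
    and \<sigma> :: "nat \<Rightarrow> nat"
  assumes "prob_space M"
    and "p \<ge> 2" and "q \<ge> 2"
    and "B \<in> carrier_mat q p"
    and "X \<in> M \<rightarrow>\<^sub>M vec_borel p"
    and "Y \<in> M \<rightarrow>\<^sub>M vec_borel q"
    and "\<epsilon> \<in> M \<rightarrow>\<^sub>M vec_borel q"
    and "\<And>w. w \<in> space M \<Longrightarrow> Y w = B *\<^sub>v X w + \<epsilon> w"
    and "prob_space.indep_var M (vec_borel p) X (vec_borel q) \<epsilon>"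
    and "centered M p X" and "centered M q Y"
    and "integrable M (\<lambda>w. vec_norm2 (X w) ^ 4)"
    and "integrable M (\<lambda>w. vec_norm2 (Y w) ^ 4)"
    and "V1 = cross_moment M p p X X"
    and "invertible_mat V1"
    and "V12 = cross_moment M p q X Y"
    and "I0 = {j \<in> {..<p}. col B j = 0\<^sub>v q}"
    and "I1 = {..<p} - I0"
    and "I0 \<noteq> {}" and "I1 \<noteq> {}"
    and "\<xi> = xi p V1 V12"
    and "ranks_decreasingly p (\<lambda>i. \<xi> ({..<p} - {i})) \<sigma>"
    and "is_dimensionality p (\<lambda>i. \<xi> ({..<p} - {i})) \<sigma> s"
  shows "I1 = {\<sigma> k | k. k < s}"
proof -
  interpret prob_space M by (rule assms(1))
  note B = assms(4)
  have int: "integrable M (\<lambda>w. X w $ i * X w $ j)" if "i < p" "j < p" for i j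
    by (rule integrable_mult_index[OF assms(5,12) that])
  have V1: "V1 \<in> carrier_mat p p" by (simp add: assms(14) cross_moment_def)
  have aniso: "u = 0\<^sub>v p" if "u \<in> carrier_vec p" "u \<bullet> (V1 *\<^sub>v u) = 0" for u
    using cross_moment_anisotropic[OF int] assms(15) that unfolding assms(14) by blast
  have V12: "V12 = V1 * transpose_mat B"
    unfolding assms(14,16)
    by (rule cross_moment_linear_model[OF B assms(5,7,8,9,10,11) int])
  have xi0: "\<xi> ({..<p} - {i}) = 0 \<longleftrightarrow> i \<in> I0" if i: "i < p" for i
  proof -
    have "transpose_mat B \<in> carrier_mat p q" using B by simp
    from xi_eq_0_iff[OF _ V1 this aniso, of "{..<p} - {i}"]
    have "\<xi> ({..<p} - {i}) = 0
        \<longleftrightarrow> (\<forall>k<p. k \<notin> {..<p} - {i} \<longrightarrow> (\<forall>j<q. transpose_mat B $$ (k, j) = 0))"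
      unfolding assms(21) V12 by blast
    also have "\<dots> \<longleftrightarrow> (\<forall>j<q. B $$ (j, i) = 0)"
      using B i by auto
    also have "\<dots> \<longleftrightarrow> i \<in> I0"
      using i B unfolding assms(17) by (auto simp: vec_eq_iff)
    finally show ?thesis .
  qed
  have \<sigma>: "\<sigma> permutes {..<p}" using assms(22) by (simp add: ranks_decreasingly_def)
  have s: "s \<le> p" and pos: "\<And>k. k < s \<Longrightarrow> \<xi> ({..<p} - {\<sigma> k}) > 0"
    and zero: "\<And>k. s \<le> k \<Longrightarrow> k < p \<Longrightarrow> \<xi> ({..<p} - {\<sigma> k}) = 0"
    using assms(23) by (auto simp: is_dimensionality_def)
  have lt: "\<sigma> k < p \<longleftrightarrow> k < p" for k using permutes_in_image[OF \<sigma>, of k] by simp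
  show ?thesis
  proof (intro equalityI subsetI)
    fix i assume "i \<in> I1"
    then have i: "i < p" "i \<notin> I0" using assms(18) by auto
    obtain k where k: "i = \<sigma> k" using permutes_surj[OF \<sigma>] by (auto elim: surjE)
    have "k < s" using zero[of k] xi0[OF i(1)] i lt k by (meson not_le)
    then show "i \<in> {\<sigma> k | k. k < s}" using k by auto
  next
    fix i assume "i \<in> {\<sigma> k | k. k < s}"
    then obtain k where k: "k < s" "i = \<sigma> k" by auto
    then have "i < p" using lt s by simp
    then show "i \<in> I1" using xi0[of i] pos[OF k(1)] k(2) assms(18) by auto
  qed
qed

end
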